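(* Let $\varphi,\psi\colon\mathbb R_+\to\mathbb R_+$ be Borel functions. Let $A$ be a closed densely defined operator in a complex Hilbert space $\mathcal H$ and let $E$ be the spectral measure of $|A|$. Set $$\mathcal H_0=\operatorname{Lin}\{E(\psi^{-1}(\sigma))Af\colon\sigma\in\mathfrak B(\mathbb R_+),\ f\in\mathcal D(A)\}.$$ Then the following conditions are equivalent: (i) $\langle E(\varphi^{-1}(\cdot))|A|f,|A|f\rangle\ll\langle E(\psi^{-1}(\cdot))Af,Af\rangle$ for all $f\in\mathcal D(A)$; (ii) there exists a (unique) linear map $T_0\colon\mathcal H_0\to\mathcal R(|A|)$ such that $T_0A=|A|$ and $T_0E(\psi^{-1}(\cdot))|_{\mathcal H_0}=E(\varphi^{-1}(\cdot))T_0$.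
   Context: All operators are linear and possibly unbounded; $\mathcal D(A)$ and $\mathcal R(A)$ denote the domain and the range of $A$; $\operatorname{Lin}$ denotes the (algebraic) linear span. $\mathbb R_+=[0,\infty)$ and $\mathfrak B(\mathbb R_+)$ is its Borel $\sigma$-algebra. For a closed densely defined $A$, $|A|$ is the square root of the positive selfadjoint operator $A^*A$, and its spectral measure is regarded as defined on $\mathfrak B(\mathbb R_+)$. $E(\varphi^{-1}(\cdot))$ stands for the spectral measure $\sigma\mapsto E(\varphi^{-1}(\sigma))$ on $\mathfrak B(\mathbb R_+)$, and similarly for $\psi$; the operator equality involving $(\cdot)$ in (ii) is understood to hold for every $\sigma\in\mathfrak B(\mathbb R_+)$ (the same $\sigma$ on both sides). For finite positive Borel measures on $\mathbb R_+$, $\mu\ll\nu$ means absolute continuity of $\mu$ with respect to $\nu$. *)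

theory Defs
  imports "HOL-Analysis.Analysis"
begin

section \<open>Complex Hilbert spaces\<close>

text \<open>
  The underlying real inner product space, with its norm and topology, is inherited from
  the class \<open>real_inner\<close>; the complex inner product is linear in its first argument.
\<close>

class complex_inner_space = real_inner +
  fixes scaleC :: "complex \<Rightarrow> 'a \<Rightarrow> 'a"  (infixr \<open>*\<^sub>C\<close> 75)
    and cinner :: "'a \<Rightarrow> 'a \<Rightarrow> complex"
  assumes scaleC_add_right: "c *\<^sub>C (x + y) = c *\<^sub>C x + c *\<^sub>C y"
    and scaleC_add_left: "(c + d) *\<^sub>C x = c *\<^sub>C x + d *\<^sub>C x"
    and scaleC_scaleC: "c *\<^sub>C d *\<^sub>C x = (c * d) *\<^sub>C x"
    and scaleC_of_real: "complex_of_real r *\<^sub>C x = scaleR r x"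
    and cinner_commute: "cinner x y = cnj (cinner y x)"
    and cinner_add_left: "cinner (x + y) z = cinner x z + cinner y z"
    and cinner_scaleC_left: "cinner (c *\<^sub>C x) y = c * cinner x y"
    and Re_cinner: "Re (cinner x y) = inner x y"

class chilbert_space = complex_inner_space + complete_space

global_interpretation complex_vector: vector_space "scaleC :: complex \<Rightarrow> 'a \<Rightarrow> 'a::complex_inner_space"
  defines csubspace = complex_vector.subspace
    and cspan = complex_vector.span
proof
  show "1 *\<^sub>C x = x" for x :: 'a
    using scaleC_of_real[of 1 x] by simp
qed (simp_all add: scaleC_add_right scaleC_add_left scaleC_scaleC)

abbreviation clinear :: "('a::complex_inner_space \<Rightarrow> 'b::complex_inner_space) \<Rightarrow> bool"
  where "clinear \<equiv> Vector_Spaces.linear scaleC scaleC"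

section \<open>Unbounded operators\<close>

text \<open>
  A possibly unbounded operator is represented by its graph, so that its domain and range are
  \<^const>\<open>Domain\<close> and \<^const>\<open>Range\<close>, and equality of operators includes equality of domains.
  In terms of graphs the product \<open>S T\<close> of operators, on its natural domain, is
  \<open>T O S\<close>.
\<close>

type_synonym 'a op_graph = "('a \<times> 'a) set"

definition linear_op :: "'a::complex_inner_space op_graph \<Rightarrow> bool" where
  "linear_op A \<longleftrightarrow> single_valued A \<and> (0, 0) \<in> A \<and>
     (\<forall>f g f' g'. (f, g) \<in> A \<longrightarrow> (f', g') \<in> A \<longrightarrow> (f + f', g + g') \<in> A) \<and>
     (\<forall>c f g. (f, g) \<in> A \<longrightarrow> (c *\<^sub>C f, c *\<^sub>C g) \<in> A)"

definition op_app :: "'a op_graph \<Rightarrow> 'a \<Rightarrow> 'a" where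
  "op_app A f = (THE g. (f, g) \<in> A)"

definition fun_graph :: "'a set \<Rightarrow> ('a \<Rightarrow> 'a) \<Rightarrow> 'a op_graph" where
  "fun_graph D P = {(f, P f) | f. f \<in> D}"

definition closed_op :: "'a::complex_inner_space op_graph \<Rightarrow> bool" where
  "closed_op A \<longleftrightarrow> linear_op A \<and> closed A"

definition densely_defined :: "'a::complex_inner_space op_graph \<Rightarrow> bool" where
  "densely_defined A \<longleftrightarrow> closure (Domain A) = UNIV"

definition op_adjoint :: "'a::complex_inner_space op_graph \<Rightarrow> 'a op_graph" where
  "op_adjoint A = {(g, h). \<forall>f k. (f, k) \<in> A \<longrightarrow> cinner k g = cinner f h}"

definition selfadjoint_op :: "'a::complex_inner_space op_graph \<Rightarrow> bool" where
  "selfadjoint_op B \<longleftrightarrow> linear_op B \<and> densely_defined B \<and> op_adjoint B = B"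

definition positive_op :: "'a::complex_inner_space op_graph \<Rightarrow> bool" where
  "positive_op B \<longleftrightarrow> (\<forall>f g. (f, g) \<in> B \<longrightarrow> Im (cinner g f) = 0 \<and> 0 \<le> Re (cinner g f))"

text \<open>
  \<open>modulus_of A B\<close> says that \<open>B\<close> is \<open>|A|\<close>, the (unique) positive selfadjoint
  operator whose square is \<open>A\<^sup>* A\<close>.
\<close>

definition modulus_of :: "'a::complex_inner_space op_graph \<Rightarrow> 'a op_graph \<Rightarrow> bool" where
  "modulus_of A B \<longleftrightarrow> selfadjoint_op B \<and> positive_op B \<and> B O B = A O op_adjoint A"

section \<open>Spectral measures on the half-line\<close>

definition borel_Rp :: "real measure" where
  "borel_Rp = restrict_space borel {0..}"

lemma space_borel_Rp [simp]: "space borel_Rp = {0..}"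
  by (simp add: borel_Rp_def space_restrict_space)

lemma sets_borel_Rp: "\<sigma> \<in> sets borel_Rp \<longleftrightarrow> \<sigma> \<in> sets borel \<and> \<sigma> \<subseteq> {0..}"
  by (subst borel_Rp_def, subst sets_restrict_space_iff) auto

definition orthogonal_projection :: "('a::complex_inner_space \<Rightarrow> 'a) \<Rightarrow> bool" where
  "orthogonal_projection P \<longleftrightarrow> clinear P \<and> (\<forall>f. P (P f) = P f) \<and>
     (\<forall>f g. cinner (P f) g = cinner f (P g))"

text \<open>
  Values of a spectral measure outside the Borel subsets of the half-line are irrelevant.
\<close>

definition spectral_measure :: "(real set \<Rightarrow> 'a::complex_inner_space \<Rightarrow> 'a) \<Rightarrow> bool" where
  "spectral_measure E \<longleftrightarrow>
     (\<forall>\<sigma>\<in>sets borel_Rp. orthogonal_projection (E \<sigma>)) \<and>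
     (\<forall>f. E {0..} f = f) \<and>
     (\<forall>F :: nat \<Rightarrow> real set. range F \<subseteq> sets borel_Rp \<longrightarrow> disjoint_family F \<longrightarrow>
        (\<forall>f. (\<lambda>n. E (F n) f) sums E (\<Union>n. F n) f))"

text \<open>The spectral measure \<open>E(\<phi>\<^sup>-\<^sup>1(\<cdot>))\<close>.\<close>

definition pullback ::
  "(real set \<Rightarrow> 'a \<Rightarrow> 'a) \<Rightarrow> (real \<Rightarrow> real) \<Rightarrow> real set \<Rightarrow> 'a \<Rightarrow> 'a" where
  "pullback E \<phi> \<sigma> = E (\<phi> -` \<sigma> \<inter> {0..})"

text \<open>
  The finite positive measure \<open>\<langle>E(\<cdot>)f,f\<rangle>\<close>; see \<open>emeasure_scalar_measure\<close> below.
\<close>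

definition scalar_measure ::
  "(real set \<Rightarrow> 'a::complex_inner_space \<Rightarrow> 'a) \<Rightarrow> 'a \<Rightarrow> real measure" where
  "scalar_measure E f =
     measure_of {0..} (sets borel_Rp) (\<lambda>\<sigma>. ennreal (Re (cinner (E \<sigma> f) f)))"

definition simple_spectral_integral ::
  "(real set \<Rightarrow> 'a::complex_inner_space \<Rightarrow> 'a) \<Rightarrow> (real \<Rightarrow> real) \<Rightarrow> 'a \<Rightarrow> 'a" where
  "simple_spectral_integral E s f = (\<Sum>y\<in>s ` {0..}. y *\<^sub>R E (s -` {y} \<inter> {0..}) f)"

text \<open>
  The operator \<open>\<integral> u dE\<close>: its domain is \<open>{f. \<integral> u\<^sup>2 d\<langle>E(\<cdot>)f,f\<rangle> < \<infinity>}\<close>, and on it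
  \<open>f \<mapsto> (\<integral> u dE) f\<close> is the extension of the integral of simple functions by means of
  the isometry \<open>s \<mapsto> (\<integral> s dE) f\<close> from \<open>L\<^sup>2(\<langle>E(\<cdot>)f,f\<rangle>)\<close>.
\<close>

definition spectral_integral ::
  "(real set \<Rightarrow> 'a::complex_inner_space \<Rightarrow> 'a) \<Rightarrow> (real \<Rightarrow> real) \<Rightarrow> 'a op_graph" where
  "spectral_integral E u = {(f, h).
     (\<integral>\<^sup>+x. ennreal ((u x)\<^sup>2) \<partial>scalar_measure E f) < \<infinity> \<and>
     (\<exists>s :: nat \<Rightarrow> real \<Rightarrow> real.
        (\<forall>n. simple_function borel_Rp (s n)) \<and>
        (\<lambda>n. \<integral>\<^sup>+x. ennreal ((u x - s n x)\<^sup>2) \<partial>scalar_measure E f) \<longlonglongrightarrow> 0 \<and>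
        (\<lambda>n. simple_spectral_integral E (s n) f) \<longlonglongrightarrow> h)}"

definition spectral_measure_of ::
  "(real set \<Rightarrow> 'a::complex_inner_space \<Rightarrow> 'a) \<Rightarrow> 'a op_graph \<Rightarrow> bool" where
  "spectral_measure_of E B \<longleftrightarrow> spectral_measure E \<and> B = spectral_integral E (\<lambda>x. x)"

section \<open>The space \<open>\<H>\<^sub>0\<close> and the map \<open>T\<^sub>0\<close>\<close>

definition H0_space ::
  "(real set \<Rightarrow> 'a::complex_inner_space \<Rightarrow> 'a) \<Rightarrow> (real \<Rightarrow> real) \<Rightarrow> 'a op_graph \<Rightarrow> 'a set" where
  "H0_space E \<psi> A =
     cspan {pullback E \<psi> \<sigma> (op_app A f) | \<sigma> f. \<sigma> \<in> sets borel_Rp \<and> f \<in> Domain A}"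

definition is_T0 ::
  "(real set \<Rightarrow> 'a::complex_inner_space \<Rightarrow> 'a) \<Rightarrow> (real \<Rightarrow> real) \<Rightarrow> (real \<Rightarrow> real) \<Rightarrow>
     'a op_graph \<Rightarrow> 'a op_graph \<Rightarrow> 'a op_graph \<Rightarrow> bool" where
  "is_T0 E \<phi> \<psi> A absA T\<^sub>0 \<longleftrightarrow>
     linear_op T\<^sub>0 \<and> Domain T\<^sub>0 = H0_space E \<psi> A \<and> Range T\<^sub>0 \<subseteq> Range absA \<and>
     A O T\<^sub>0 = absA \<and>
     (\<forall>\<sigma>\<in>sets borel_Rp.
        fun_graph (H0_space E \<psi> A) (pullback E \<psi> \<sigma>) O T\<^sub>0 =
        T\<^sub>0 O fun_graph UNIV (pullback E \<phi> \<sigma>))"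

section \<open>Sanity checks\<close>

lemma spectral_measure_pullback:
  assumes E: "spectral_measure E" and \<phi>: "\<phi> \<in> borel_Rp \<rightarrow>\<^sub>M borel_Rp"
  shows "spectral_measure (pullback E \<phi>)"
  unfolding spectral_measure_def
proof (intro conjI ballI allI impI)
  have meas: "\<phi> -` \<sigma> \<inter> {0..} \<in> sets borel_Rp" if "\<sigma> \<in> sets borel_Rp" for \<sigma>
    using measurable_sets[OF \<phi> that] by simp
  show "orthogonal_projection (pullback E \<phi> \<sigma>)" if "\<sigma> \<in> sets borel_Rp" for \<sigma>
    using E meas[OF that] by (simp add: spectral_measure_def pullback_def)
  have "\<phi> -` {0..} \<inter> {0..} = {0..}"
    using measurable_space[OF \<phi>] by auto
  then show "pullback E \<phi> {0..} f = f" for f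
    using E by (simp add: spectral_measure_def pullback_def)
  fix F :: "nat \<Rightarrow> real set" and f
  assume F: "range F \<subseteq> sets borel_Rp" and disj: "disjoint_family F"
  have 1: "range (\<lambda>n. \<phi> -` F n \<inter> {0..}) \<subseteq> sets borel_Rp"
    using F meas by blast
  have 2: "disjoint_family (\<lambda>n. \<phi> -` F n \<inter> {0..})"
    using disj by (auto simp: disjoint_family_on_def)
  have "\<phi> -` (\<Union>n. F n) \<inter> {0..} = (\<Union>n. \<phi> -` F n \<inter> {0..})"
    by auto
  moreover have "(\<lambda>n. E (\<phi> -` F n \<inter> {0..}) f) sums E (\<Union>n. \<phi> -` F n \<inter> {0..}) f"
    using E 1 2 unfolding spectral_measure_def by blast
  ultimately show "(\<lambda>n. pullback E \<phi> (F n) f) sums pullback E \<phi> (\<Union>n. F n) f"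
    by (simp add: pullback_def)
qed

lemma cinner_projection_self:
  assumes "orthogonal_projection P"
  shows "cinner (P f) f = of_real ((norm (P f))\<^sup>2)"
proof -
  have eq: "cinner (P f) f = cinner (P f) (P f)"
    using assms by (metis orthogonal_projection_def)
  have "Im (cinner (P f) (P f)) = 0"
    using arg_cong[OF cinner_commute[of "P f" "P f"], of Im] by simp
  with eq show ?thesis
    by (simp add: complex_eq_iff Re_cinner power2_norm_eq_inner)
qed

lemma sets_scalar_measure [simp]: "sets (scalar_measure E f) = sets borel_Rp"
  and space_scalar_measure [simp]: "space (scalar_measure E f) = {0..}"
  using sets.sigma_sets_eq[of borel_Rp] sets.space_closed[of borel_Rp]
  by (simp_all add: scalar_measure_def)

lemma emeasure_scalar_measure:
  assumes E: "spectral_measure E" and \<sigma>: "\<sigma> \<in> sets borel_Rp"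
  shows "emeasure (scalar_measure E f) \<sigma> = ennreal (Re (cinner (E \<sigma> f) f))"
proof (rule emeasure_measure_of)
  let ?\<mu> = "\<lambda>\<sigma>. ennreal (Re (cinner (E \<sigma> f) f))"
  show "scalar_measure E f = measure_of {0..} (sets borel_Rp) ?\<mu>"
    by (simp add: scalar_measure_def)
  show "sets borel_Rp \<subseteq> Pow {0..}"
    using sets.space_closed[of borel_Rp] by simp
  have nonneg: "0 \<le> Re (cinner (E \<sigma> f) f)" if "\<sigma> \<in> sets borel_Rp" for \<sigma>
  proof -
    have "orthogonal_projection (E \<sigma>)"
      using E that by (simp add: spectral_measure_def)
    from cinner_projection_self[OF this, of f] show ?thesis by simp
  qed
  have sums: "(\<lambda>n. E (F n) f) sums E (\<Union>n. F n) f"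
    if "range F \<subseteq> sets borel_Rp" "disjoint_family F" for F :: "nat \<Rightarrow> real set"
    using E that unfolding spectral_measure_def by blast
  show "positive (sets (scalar_measure E f)) ?\<mu>"
  proof -
    have "(\<lambda>n::nat. E {} f) sums E {} f"
      using sums[of "\<lambda>n. {}"] by (simp add: disjoint_family_on_def)
    then have "E {} f = 0"
      using summable_LIMSEQ_zero[of "\<lambda>n::nat. E {} f"]
      by (simp add: sums_iff LIMSEQ_const_iff)
    then show ?thesis
      by (simp add: positive_def Re_cinner)
  qed
  show "countably_additive (sets (scalar_measure E f)) ?\<mu>"
  proof (rule countably_additiveI)
    fix F :: "nat \<Rightarrow> real set"
    assume F: "range F \<subseteq> sets (scalar_measure E f)" and "disjoint_family F"
      and U: "(\<Union>n. F n) \<in> sets (scalar_measure E f)"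
    then have "(\<lambda>n. E (F n) f) sums E (\<Union>n. F n) f"
      by (intro sums) auto
    then have "(\<lambda>n. Re (cinner (E (F n) f) f)) sums Re (cinner (E (\<Union>n. F n) f) f)"
      unfolding Re_cinner by (rule bounded_linear.sums[OF bounded_linear_inner_left])
    moreover have "0 \<le> Re (cinner (E (F n) f) f)" for n
      using F by (intro nonneg) auto
    ultimately show "(\<Sum>n. ?\<mu> (F n)) = ?\<mu> (\<Union>n. F n)"
      by (intro suminf_ennreal_eq)
  qed
  show "\<sigma> \<in> sets (scalar_measure E f)"
    using \<sigma> by simp
qed

end

theory Submission imports Defs
begin

text \<open>
  Since \<open>T\<^sub>0\<close> must send \<open>E(\<psi>\<^sup>-\<^sup>1(\<sigma>)) A f\<close> to \<open>E(\<phi>\<^sup>-\<^sup>1(\<sigma>)) |A| f\<close>, it is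
  determined on \<open>\<H>\<^sub>0\<close>, and the only question is whether this prescription is well defined.
  A vanishing combination of the former vectors can be rewritten over disjoint sets, where
  orthogonality makes each term vanish separately; absolute continuity then kills the
  corresponding term on the other side, because \<open>E(\<psi>\<^sup>-\<^sup>1(\<sigma>)) A f = 0\<close> says exactly that
  \<open>\<sigma>\<close> is a null set of \<open>\<langle>E(\<psi>\<^sup>-\<^sup>1(\<cdot>))Af, Af\<rangle>\<close>. The operators \<open>A\<close> and \<open>|A|\<close> have the
  same domain since \<open>\<D>(A\<^sup>* A)\<close> is a core for both and \<open>\<parallel>A g\<parallel> = \<parallel>|A| g\<parallel>\<close> there; the
  range of \<open>T\<^sub>0\<close> lies in that of \<open>|A|\<close> because \<open>E\<close> commutes with \<open>|A|\<close>.
\<close>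

section \<open>Orthogonal projection onto closed subspaces\<close>

text \<open>A minimising sequence for the distance to \<open>x\<close> is Cauchy, completeness turns
  it into a nearest point, and the residual at a nearest point is orthogonal to \<open>S\<close>.
  The inner product is real because the lemma is applied to graphs inside the product space.\<close>

lemma closed_subspace_orthogonal_residual:
  fixes S :: "'b::{real_inner, complete_space} set"
  assumes S: "subspace S" and clo: "closed S"
  shows "\<exists>p\<in>S. \<forall>y\<in>S. inner (x - p) y = 0"
proof -
  define d where "d = (INF y\<in>S. (norm (x - y))\<^sup>2)"
  have bdd: "bdd_below ((\<lambda>y. (norm (x - y))\<^sup>2) ` S)"
    by (rule bdd_belowI2[of _ 0]) simp
  have ne: "S \<noteq> {}"
    using subspace_0[OF S] by blast
  have d_le: "d \<le> (norm (x - y))\<^sup>2" if "y \<in> S" for y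
    unfolding d_def using cINF_lower[OF bdd that] .
  have "\<exists>y\<in>S. (norm (x - y))\<^sup>2 < d + inverse (real (Suc n))" for n
    using cINF_less_iff[OF ne bdd, of "d + inverse (real (Suc n))"] by (simp add: d_def)
  then obtain s where s: "\<And>n. s n \<in> S"
    and s_less: "\<And>n. (norm (x - s n))\<^sup>2 < d + inverse (real (Suc n))"
    by metis
  have par: "(norm (s m - s n))\<^sup>2 \<le> 2 * inverse (real (Suc m)) + 2 * inverse (real (Suc n))" for m n
  proof -
    let ?c = "(1/2) *\<^sub>R (s m + s n)"
    have "?c \<in> S"
      using S s by (intro subspace_scale subspace_add) auto
    then have "d \<le> (norm (x - ?c))\<^sup>2"
      by (rule d_le)
    \<comment> \<open>Parallelogram law for \<open>x - s m\<close> and \<open>x - s n\<close>, whose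
      half sum is \<open>x - ?c\<close>; the squared distance of the midpoint is at least
      \<open>d\<close>.\<close>
    moreover have "(norm (s m - s n))\<^sup>2
        = 2 * (norm (x - s m))\<^sup>2 + 2 * (norm (x - s n))\<^sup>2 - 4 * (norm (x - ?c))\<^sup>2"
      by (simp add: power2_norm_eq_inner inner_diff inner_add inner_commute algebra_simps)
    ultimately show ?thesis
      using s_less[of m] s_less[of n] by linarith
  qed
  have "Cauchy s"
  proof (rule metric_CauchyI)
    fix e :: real assume e: "0 < e"
    obtain N where N: "inverse (real (Suc N)) < e\<^sup>2 / 4"
      using reals_Archimedean[of "e\<^sup>2 / 4"] e by auto
    show "\<exists>M. \<forall>m\<ge>M. \<forall>n\<ge>M. dist (s m) (s n) < e"
    proof (intro exI[of _ N] allI impI)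
      fix m n assume mn: "N \<le> m" "N \<le> n"
      have "inverse (real (Suc m)) \<le> inverse (real (Suc N))"
        "inverse (real (Suc n)) \<le> inverse (real (Suc N))"
        using mn by (auto intro!: le_imp_inverse_le)
      with par[of m n] N have "(norm (s m - s n))\<^sup>2 < e\<^sup>2"
        by linarith
      then show "dist (s m) (s n) < e"
        using e by (simp add: dist_norm power2_less_imp_less)
    qed
  qed
  then obtain p where p: "s \<longlonglongrightarrow> p"
    using Cauchy_convergent convergent_def by blast
  have pS: "p \<in> S"
    using closed_sequentially[OF clo s p] .
  have "(\<lambda>n. (norm (x - s n))\<^sup>2) \<longlonglongrightarrow> (norm (x - p))\<^sup>2"
    by (intro tendsto_intros p)
  moreover have "(\<lambda>n. d + inverse (real (Suc n))) \<longlonglongrightarrow> d + 0"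
    by (intro tendsto_intros LIMSEQ_inverse_real_of_nat)
  ultimately have p_le: "(norm (x - p))\<^sup>2 \<le> d"
    using s_less by (intro LIMSEQ_le[where X="\<lambda>n. (norm (x - s n))\<^sup>2"]) (auto intro: less_imp_le)
  have norm_diff: "(norm (w - t *\<^sub>R y))\<^sup>2 = (norm w)\<^sup>2 - 2 * t * inner w y + t\<^sup>2 * inner y y"
    for w y :: 'b and t
    unfolding power2_norm_eq_inner inner_diff_left inner_diff_right
    by (simp add: inner_commute[of y w] power2_eq_square)
  have "inner (x - p) y = 0" if y: "y \<in> S" for y
  proof (cases "y = 0")
    case False
    \<comment> \<open>This value minimises the norm of \<open>(x - p) - t *\<^sub>R y\<close>, so a
      nonzero inner product would give a point of \<open>S\<close> strictly closer to
      \<open>x\<close> than \<open>p\<close>.\<close>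
    define t where "t = inner (x - p) y / inner y y"
    have "p + t *\<^sub>R y \<in> S"
      using S pS y by (intro subspace_add subspace_scale)
    then have "(norm (x - p))\<^sup>2 \<le> (norm (x - (p + t *\<^sub>R y)))\<^sup>2"
      by (rule order_trans[OF p_le d_le])
    also have "\<dots> = (norm ((x - p) - t *\<^sub>R y))\<^sup>2"
      by (simp only: diff_diff_eq)
    also have "\<dots> = (norm (x - p))\<^sup>2 - 2 * t * inner (x - p) y + t\<^sup>2 * inner y y"
      by (rule norm_diff)
    also have "\<dots> = (norm (x - p))\<^sup>2 - (inner (x - p) y)\<^sup>2 / inner y y"
      unfolding t_def using False by (simp add: power2_eq_square)
    finally have "(inner (x - p) y)\<^sup>2 / inner y y \<le> 0"
      by simp
    moreover have "0 < inner y y"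
      using False by simp
    ultimately show ?thesis
      by (simp add: divide_le_0_iff)
  qed simp
  with pS show ?thesis
    by blast
qed

lemma subspace_closure:
  fixes S :: "'b::real_normed_vector set"
  assumes "subspace S"
  shows "subspace (closure S)"
  unfolding subspace_def
proof (intro conjI ballI allI)
  show "0 \<in> closure S"
    using subspace_0[OF assms] closure_subset by blast
next
  fix x y assume "x \<in> closure S" "y \<in> closure S"
  then obtain f g where "\<And>n. f n \<in> S" "f \<longlonglongrightarrow> x" "\<And>n. g n \<in> S" "g \<longlonglongrightarrow> y"
    unfolding closure_sequential by blast
  then have "(\<forall>n. f n + g n \<in> S) \<and> (\<lambda>n. f n + g n) \<longlonglongrightarrow> x + y"
    by (blast intro: subspace_add[OF assms] tendsto_add)
  then show "x + y \<in> closure S"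
    unfolding closure_sequential by (intro CollectI exI[of _ "\<lambda>n. f n + g n"])
next
  fix c x assume "x \<in> closure S"
  then obtain f where "\<And>n. f n \<in> S" "f \<longlonglongrightarrow> x"
    unfolding closure_sequential by blast
  then have "(\<forall>n. c *\<^sub>R f n \<in> S) \<and> (\<lambda>n. c *\<^sub>R f n) \<longlonglongrightarrow> c *\<^sub>R x"
    by (intro conjI allI subspace_scale[OF assms] tendsto_scaleR tendsto_const)
  then show "c *\<^sub>R x \<in> closure S"
    unfolding closure_sequential by (intro CollectI exI[of _ "\<lambda>n. c *\<^sub>R f n"])
qed

section \<open>The domain of the modulus\<close>

text \<open>Reduces equations between complex inner products to pairs of real ones, where continuity
  and bilinearity are at hand.\<close>

lemma cinner_eq_Complex: "cinner x y = Complex (inner x y) (- inner (\<i> *\<^sub>C x) y)"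
proof -
  have "Re (cinner (\<i> *\<^sub>C x) y) = - Im (cinner x y)"
    by (simp add: cinner_scaleC_left)
  then show ?thesis
    by (simp add: complex_eq_iff Re_cinner)
qed

lemma linear_op_zero: "linear_op A \<Longrightarrow> (0, 0) \<in> A"
  and linear_op_add: "linear_op A \<Longrightarrow> (f, g) \<in> A \<Longrightarrow> (f', g') \<in> A \<Longrightarrow> (f + f', g + g') \<in> A"
  and linear_op_scaleC: "linear_op A \<Longrightarrow> (f, g) \<in> A \<Longrightarrow> (c *\<^sub>C f, c *\<^sub>C g) \<in> A"
  and linear_op_unique: "linear_op A \<Longrightarrow> (f, g) \<in> A \<Longrightarrow> (f, g') \<in> A \<Longrightarrow> g = g'"
  unfolding linear_op_def single_valued_def by blast+

lemma linear_op_subspace: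
  assumes "linear_op A"
  shows "subspace A"
  unfolding subspace_def
proof (intro conjI ballI allI)
  show "0 \<in> A"
    using linear_op_zero[OF assms] by (simp add: zero_prod_def)
  show "x + y \<in> A" if "x \<in> A" "y \<in> A" for x y
    using linear_op_add[OF assms, of "fst x" "snd x" "fst y" "snd y"] that
    by (simp add: plus_prod_def)
  show "c *\<^sub>R x \<in> A" if "x \<in> A" for c x
    using linear_op_scaleC[OF assms, of "fst x" "snd x" "complex_of_real c"] that
    by (simp add: scaleR_prod_def scaleC_of_real)
qed

lemma op_app_eq: "linear_op A \<Longrightarrow> (f, g) \<in> A \<Longrightarrow> op_app A f = g"
  unfolding op_app_def by (blast intro: linear_op_unique)

section \<open>Adjoints, and a core for a closed operator\<close>

text \<open>The graph is an intersection of closed conditions. It serves to show that the modulus,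
  being its own adjoint, is closed.\<close>

lemma closed_op_adjoint: "closed (op_adjoint A)"
proof -
  have eq: "op_adjoint A = (\<Inter>(f, k)\<in>A. {z. cinner k (fst z) = cinner f (snd z)})"
    by (auto simp: op_adjoint_def)
  have "closed {z. cinner k (fst z) = cinner f (snd z)}" for f k :: 'a
    unfolding cinner_eq_Complex complex.inject
    by (intro closed_Collect_conj closed_Collect_eq continuous_intros)
  then show ?thesis
    unfolding eq by (intro closed_INT) auto
qed

lemma op_adjoint_add:
  assumes "(g, h) \<in> op_adjoint A" "(g', h') \<in> op_adjoint A"
  shows "(g + g', h + h') \<in> op_adjoint A"
  using assms unfolding op_adjoint_def
  by (auto simp: cinner_eq_Complex inner_add_right)

lemma op_adjoint_scaleR:
  assumes "(g, h) \<in> op_adjoint A"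
  shows "(c *\<^sub>R g, c *\<^sub>R h) \<in> op_adjoint A"
  using assms unfolding op_adjoint_def
  by (auto simp: cinner_eq_Complex)

text \<open>
  Von Neumann: splitting \<open>(h, 0)\<close> along the graph of \<open>A\<close> and its orthogonal
  complement shows that \<open>I + A\<^sup>* A\<close> is onto.
\<close>

lemma one_plus_adjoint_product_surj:
  fixes A :: "'a::chilbert_space op_graph"
  assumes "closed_op A"
  obtains g k u where "(g, k) \<in> A" "(k, u) \<in> op_adjoint A" "g + u = h"
proof -
  have lin: "linear_op A" and clo: "closed A"
    using assms by (auto simp: closed_op_def)
  obtain p where p: "p \<in> A" and ortho: "\<And>y. y \<in> A \<Longrightarrow> inner ((h, 0) - p) y = 0"
    using closed_subspace_orthogonal_residual[OF linear_op_subspace[OF lin] clo] by blast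
  obtain g k where gk: "p = (g, k)"
    by (cases p)
  have "inner l k = inner f (h - g)" if "(f, l) \<in> A" for f l
    using ortho[OF that] by (simp add: gk inner_prod_def inner_commute)
  \<comment> \<open>Orthogonality gives only the real part of the adjoint relation; applying it to
    \<i> times an element of the graph gives the imaginary part.\<close>
  then have "(k, h - g) \<in> op_adjoint A"
    unfolding op_adjoint_def using linear_op_scaleC[OF lin, of _ _ "\<i>"]
    by (auto simp: cinner_eq_Complex)
  then show ?thesis
    using that[of g k "h - g"] p gk by simp
qed

text \<open>Let \<open>(x, y)\<close> in the graph be orthogonal to the closure of the restricted
  graph. Surjectivity of the identity plus \<open>A O op_adjoint A\<close> provides \<open>g\<close>
  in the restricted domain with image \<open>x\<close>, and the orthogonality of
  \<open>(x, y)\<close> to the graph element over \<open>g\<close> then reads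
  \<open>inner x x = 0\<close>.\<close>

lemma adjoint_product_core:
  fixes A :: "'a::chilbert_space op_graph"
  assumes "closed_op A"
  shows "A \<subseteq> closure {z \<in> A. snd z \<in> Domain (op_adjoint A)}" (is "A \<subseteq> closure ?C")
proof
  fix z assume z: "z \<in> A"
  have lin: "linear_op A" and clo: "closed A"
    using assms by (auto simp: closed_op_def)
  note sub = linear_op_subspace[OF lin]
  have "subspace ?C"
    unfolding subspace_def
  proof (intro conjI ballI allI)
    have "(0, 0) \<in> op_adjoint A"
      by (simp add: op_adjoint_def cinner_eq_Complex)
    then show "0 \<in> ?C"
      by (simp add: subspace_0[OF sub] DomainI)
  next
    fix x y assume xy: "x \<in> ?C" "y \<in> ?C"
    then obtain h h' where "(snd x, h) \<in> op_adjoint A" "(snd y, h') \<in> op_adjoint A"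
      by blast
    then have "snd x + snd y \<in> Domain (op_adjoint A)"
      by (rule op_adjoint_add[THEN DomainI])
    with xy show "x + y \<in> ?C"
      by (simp add: subspace_add[OF sub])
  next
    fix c x assume x: "x \<in> ?C"
    then obtain h where "(snd x, h) \<in> op_adjoint A"
      by blast
    then have "c *\<^sub>R snd x \<in> Domain (op_adjoint A)"
      by (rule op_adjoint_scaleR[THEN DomainI])
    with x show "c *\<^sub>R x \<in> ?C"
      by (simp add: subspace_scale[OF sub])
  qed
  then obtain p where p: "p \<in> closure ?C"
    and ortho: "\<And>y. y \<in> closure ?C \<Longrightarrow> inner (z - p) y = 0"
    using closed_subspace_orthogonal_residual[OF subspace_closure closed_closure] by blast
  have "closure ?C \<subseteq> A"
    by (rule closure_minimal[OF _ clo]) auto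
  then have "z - p \<in> A"
    using p z subspace_diff[OF sub] by blast
  obtain x y where xy: "z - p = (x, y)"
    by (cases "z - p")
  with \<open>z - p \<in> A\<close> have xyA: "(x, y) \<in> A"
    by simp
  obtain g k u where gku: "(g, k) \<in> A" "(k, u) \<in> op_adjoint A" "g + u = x"
    using one_plus_adjoint_product_surj[OF assms] by blast
  have "(g, k) \<in> closure ?C"
    using gku by (intro subsetD[OF closure_subset]) auto
  from ortho[OF this] have "inner x g + inner y k = 0"
    by (simp add: xy)
  moreover have "inner y k = inner x u"
    using gku(2) xyA by (auto simp: op_adjoint_def cinner_eq_Complex)
  ultimately have "inner x x = 0"
    using gku(3) by (metis inner_add_right)
  then have "x = 0"
    by simp
  with xyA have "y = 0"
    using linear_op_unique[OF lin] linear_op_zero[OF lin] by blast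
  with \<open>x = 0\<close> xy have "z = p"
    by (metis eq_iff_diff_eq_0 zero_prod_def)
  with p show "z \<in> closure ?C"
    by simp
qed

text \<open>The right side involves only \<open>f\<close> and its image under
  \<open>A O op_adjoint A\<close>. Hence two operators with the same such product have equal norms
  on the domain of the product.\<close>

lemma adjoint_product_norm:
  assumes "(f, k) \<in> A" "(k, h) \<in> op_adjoint A"
  shows "(norm k)\<^sup>2 = inner f h"
  using assms by (auto simp: op_adjoint_def cinner_eq_Complex power2_norm_eq_inner)

text \<open>Approximate \<open>(f, k)\<close> in the graph of \<open>A\<close> by elements over the
  core. The core vectors lie in the domain of \<open>B\<close> too, their images under
  \<open>B\<close> form a Cauchy sequence because differences have the same norms under
  \<open>A\<close> and \<open>B\<close>, and closedness of \<open>B\<close> puts \<open>f\<close> in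
  its domain.\<close>

lemma Domain_mono_adjoint_product:
  fixes A B :: "'a::chilbert_space op_graph"
  assumes A: "closed_op A" and B: "closed_op B"
    and eq: "A O op_adjoint A = B O op_adjoint B"
  shows "Domain A \<subseteq> Domain B"
proof
  fix f assume "f \<in> Domain A"
  then obtain k where "(f, k) \<in> A"
    by blast
  then have "(f, k) \<in> closure {z \<in> A. snd z \<in> Domain (op_adjoint A)}"
    using adjoint_product_core[OF A] by blast
  then obtain z where z: "\<And>n. z n \<in> A" "\<And>n. snd (z n) \<in> Domain (op_adjoint A)"
    and lim: "z \<longlonglongrightarrow> (f, k)"
    unfolding closure_sequential by blast
  have linB: "linear_op B" and cloB: "closed B" and linA: "linear_op A"
    using A B by (auto simp: closed_op_def)
  from z(2) obtain h where h: "\<And>n. (snd (z n), h n) \<in> op_adjoint A"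
    unfolding Domain_iff by metis
  have zA: "(fst (z n), snd (z n)) \<in> A" for n
    using z(1) by simp
  then have "(fst (z n), h n) \<in> B O op_adjoint B" for n
    unfolding eq[symmetric] using h by (rule relcompI)
  then have "\<exists>b. (fst (z n), b) \<in> B \<and> (b, h n) \<in> op_adjoint B" for n
    by blast
  then obtain b where b: "\<And>n. (fst (z n), b n) \<in> B" "\<And>n. (b n, h n) \<in> op_adjoint B"
    by metis
  \<comment> \<open>Both sides are determined by \<open>fst (z m) - fst (z n)\<close> and
    \<open>h m - h n\<close>, which are common to the two operators.\<close>
  have diff: "norm (b m - b n) = norm (snd (z m) - snd (z n))" for m n
  proof -
    have "(fst (z m) - fst (z n), b m - b n) \<in> B"
      using subspace_diff[OF linear_op_subspace[OF linB] b(1)[of m] b(1)[of n]] by simp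
    moreover have "(b m - b n, h m - h n) \<in> op_adjoint B"
      using op_adjoint_add[OF b(2)[of m] op_adjoint_scaleR[OF b(2)[of n], of "-1"]] by simp
    moreover have "(fst (z m) - fst (z n), snd (z m) - snd (z n)) \<in> A"
      using subspace_diff[OF linear_op_subspace[OF linA] zA[of m] zA[of n]]
      by (simp only: diff_Pair)
    moreover have "(snd (z m) - snd (z n), h m - h n) \<in> op_adjoint A"
      using op_adjoint_add[OF h[of m] op_adjoint_scaleR[OF h[of n], of "-1"]] by simp
    ultimately have "(norm (b m - b n))\<^sup>2 = (norm (snd (z m) - snd (z n)))\<^sup>2"
      by (simp add: adjoint_product_norm)
    then show ?thesis
      by simp
  qed
  have "Cauchy (\<lambda>n. snd (z n))"
    by (rule LIMSEQ_imp_Cauchy[OF tendsto_snd[OF lim]])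
  then have "Cauchy b"
    by (simp add: Cauchy_def dist_norm diff)
  then obtain l where "b \<longlonglongrightarrow> l"
    using Cauchy_convergent convergent_def by blast
  with tendsto_fst[OF lim] have "(\<lambda>n. (fst (z n), b n)) \<longlonglongrightarrow> (f, l)"
    by (simp add: tendsto_Pair)
  then have "(f, l) \<in> B"
    by (rule closed_sequentially[OF cloB b(1)])
  then show "f \<in> Domain B"
    by blast
qed

text \<open>Selfadjointness turns \<open>B O B\<close> into \<open>B O op_adjoint B\<close> and
  makes \<open>B\<close> closed, so the inclusion of domains applies in both directions.\<close>

lemma modulus_of_Domain:
  fixes A B :: "'a::chilbert_space op_graph"
  assumes A: "closed_op A" and mod: "modulus_of A B"
  shows "Domain A = Domain B"
proof -
  have adj: "op_adjoint B = B" and "linear_op B" and eq: "A O op_adjoint A = B O op_adjoint B"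
    using mod by (auto simp: modulus_of_def selfadjoint_op_def)
  then have "closed_op B"
    unfolding closed_op_def using closed_op_adjoint[of B] by simp
  with A eq show ?thesis
    by (intro equalityI Domain_mono_adjoint_product) auto
qed

section \<open>Spectral measures\<close>

lemma orthogonal_projection_add: "orthogonal_projection P \<Longrightarrow> P (x + y) = P x + P y"
  and orthogonal_projection_scaleC: "orthogonal_projection P \<Longrightarrow> P (c *\<^sub>C x) = c *\<^sub>C P x"
  and orthogonal_projection_idem: "orthogonal_projection P \<Longrightarrow> P (P x) = P x"
  unfolding orthogonal_projection_def Vector_Spaces.linear_def module_hom_def module_hom_axioms_def
  by blast+

lemma orthogonal_projection_norm_le:
  assumes P: "orthogonal_projection P"
  shows "norm (P x) \<le> norm x"
proof -
  have "(norm (P x))\<^sup>2 = inner (P x) x"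
    using arg_cong[OF cinner_projection_self[OF P, of x], of Re] by (simp add: Re_cinner)
  also have "\<dots> \<le> norm (P x) * norm x"
    by (rule norm_cauchy_schwarz)
  finally show ?thesis
    by (cases "norm (P x) = 0") (simp_all add: power2_eq_square)
qed

lemma orthogonal_projection_bounded_linear:
  assumes P: "orthogonal_projection P"
  shows "bounded_linear P"
proof (rule bounded_linear_intro[where K=1])
  show "P (x + y) = P x + P y" for x y
    by (rule orthogonal_projection_add[OF P])
  show "P (r *\<^sub>R x) = r *\<^sub>R P x" for r x
    using orthogonal_projection_scaleC[OF P, of "complex_of_real r"] by (simp add: scaleC_of_real)
  show "norm (P x) \<le> norm x * 1" for x
    using orthogonal_projection_norm_le[OF P] by simp
qed

locale spectral_measure_space =
  fixes E :: "real set \<Rightarrow> 'a::complex_inner_space \<Rightarrow> 'a"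
  assumes spectral: "spectral_measure E"
begin

lemma proj: "\<sigma> \<in> sets borel_Rp \<Longrightarrow> orthogonal_projection (E \<sigma>)"
  using spectral by (simp add: spectral_measure_def)

lemmas E_add = orthogonal_projection_add[OF proj]
  and E_scaleC = orthogonal_projection_scaleC[OF proj]
  and E_idem = orthogonal_projection_idem[OF proj]

lemma E_zero: "\<sigma> \<in> sets borel_Rp \<Longrightarrow> E \<sigma> 0 = 0"
  using orthogonal_projection_bounded_linear[OF proj] by (simp add: linear_0 bounded_linear.linear)

lemma E_space: "E {0..} f = f"
  using spectral by (simp add: spectral_measure_def)

text \<open>Countable additivity over copies of the empty set makes a constant series converge,
  which forces its term to vanish.\<close>

lemma E_empty: "E {} f = 0"
proof -
  have "(\<lambda>n::nat. E {} f) sums E (\<Union>n::nat. {}) f"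
    using spectral unfolding spectral_measure_def
    by (auto simp: disjoint_family_on_def dest!: spec[where x="\<lambda>n. {}"])
  then show ?thesis
    using summable_LIMSEQ_zero[of "\<lambda>n::nat. E {} f"] by (simp add: sums_iff LIMSEQ_const_iff)
qed

lemma E_Un:
  assumes "\<sigma> \<in> sets borel_Rp" "\<tau> \<in> sets borel_Rp" "\<sigma> \<inter> \<tau> = {}"
  shows "E (\<sigma> \<union> \<tau>) f = E \<sigma> f + E \<tau> f"
proof -
  have "range (binaryset \<sigma> \<tau>) \<subseteq> sets borel_Rp"
    using assms by (simp add: range_binaryset_eq)
  moreover have "disjoint_family (binaryset \<sigma> \<tau>)"
    using assms(3) by (auto simp: disjoint_family_on_def binaryset_def)
  ultimately have "(\<lambda>n. E (binaryset \<sigma> \<tau> n) f) sums E (\<Union>n. binaryset \<sigma> \<tau> n) f"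
    using spectral unfolding spectral_measure_def by blast
  moreover have "(\<lambda>n. E (binaryset \<sigma> \<tau> n) f) sums (\<Sum>n<2. E (binaryset \<sigma> \<tau> n) f)"
    by (rule sums_finite) (auto simp: binaryset_def E_empty)
  ultimately show ?thesis
    by (auto simp: UN_binaryset_eq binaryset_def numeral_2_eq_2 dest: sums_unique2)
qed

text \<open>The sum of the two projections is the projection of the union, hence a contraction. On
  \<open>?g\<close>, which \<open>E \<sigma>\<close> fixes, this leaves no room for a nonzero
  \<open>E \<tau> ?g\<close>.\<close>

lemma E_disjoint:
  assumes \<sigma>: "\<sigma> \<in> sets borel_Rp" and \<tau>: "\<tau> \<in> sets borel_Rp" and disj: "\<sigma> \<inter> \<tau> = {}"
  shows "E \<tau> (E \<sigma> f) = 0"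
proof -
  have sq: "inner (E \<rho> g) g = (norm (E \<rho> g))\<^sup>2" if "\<rho> \<in> sets borel_Rp" for \<rho> g
    using arg_cong[OF cinner_projection_self[OF proj[OF that], of g], of Re]
    by (simp only: Re_cinner Re_complex_of_real)
  have un: "\<sigma> \<union> \<tau> \<in> sets borel_Rp"
    using \<sigma> \<tau> by blast
  let ?g = "E \<sigma> f"
  have "(norm ?g)\<^sup>2 + (norm (E \<tau> ?g))\<^sup>2 = inner (E \<sigma> ?g + E \<tau> ?g) ?g"
    using sq[OF \<sigma>, of ?g] sq[OF \<tau>, of ?g] by (simp only: inner_add_left E_idem[OF \<sigma>])
  also have "\<dots> = (norm (E (\<sigma> \<union> \<tau>) ?g))\<^sup>2"
    using sq[OF un, of ?g] by (simp only: E_Un[OF \<sigma> \<tau> disj])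
  also have "\<dots> \<le> (norm ?g)\<^sup>2"
    by (intro power_mono orthogonal_projection_norm_le[OF proj[OF un]]) simp
  finally show ?thesis
    by simp
qed

text \<open>Split first \<tau> and then \<sigma> along their intersection: the terms with disjoint
  sets vanish and idempotence handles the remaining one.\<close>

lemma E_Int:
  assumes \<sigma>: "\<sigma> \<in> sets borel_Rp" and \<tau>: "\<tau> \<in> sets borel_Rp"
  shows "E \<sigma> (E \<tau> f) = E (\<sigma> \<inter> \<tau>) f"
proof -
  have m: "\<sigma> \<inter> \<tau> \<in> sets borel_Rp" "\<tau> - \<sigma> \<in> sets borel_Rp" "\<sigma> - \<tau> \<in> sets borel_Rp"
    using \<sigma> \<tau> by auto
  have "E (\<sigma> \<inter> \<tau> \<union> (\<tau> - \<sigma>)) f = E (\<sigma> \<inter> \<tau>) f + E (\<tau> - \<sigma>) f"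
    using m by (intro E_Un) auto
  moreover have "\<sigma> \<inter> \<tau> \<union> (\<tau> - \<sigma>) = \<tau>" "\<sigma> \<inter> \<tau> \<union> (\<sigma> - \<tau>) = \<sigma>"
    by auto
  moreover have "E \<sigma> (E (\<tau> - \<sigma>) f) = 0"
    using m \<sigma> by (intro E_disjoint) auto
  moreover have "E (\<sigma> \<inter> \<tau> \<union> (\<sigma> - \<tau>)) (E (\<sigma> \<inter> \<tau>) f)
      = E (\<sigma> \<inter> \<tau>) (E (\<sigma> \<inter> \<tau>) f) + E (\<sigma> - \<tau>) (E (\<sigma> \<inter> \<tau>) f)"
    using m by (intro E_Un) auto
  moreover have "E (\<sigma> - \<tau>) (E (\<sigma> \<inter> \<tau>) f) = 0"
    using m by (intro E_disjoint) auto
  ultimately show ?thesis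
    using \<sigma> m by (simp add: E_add E_idem)
qed

text \<open>The mass of \<sigma> is the squared norm of \<open>E \<sigma> f\<close>. This turns
  absolute continuity into an implication between vanishing vectors.\<close>

lemma null_sets_scalar_measure:
  "\<sigma> \<in> null_sets (scalar_measure E f) \<longleftrightarrow> \<sigma> \<in> sets borel_Rp \<and> E \<sigma> f = 0"
proof -
  have "emeasure (scalar_measure E f) \<sigma> = 0 \<longleftrightarrow> E \<sigma> f = 0" if "\<sigma> \<in> sets borel_Rp"
    using cinner_projection_self[OF proj[OF that], of f]
    by (simp add: emeasure_scalar_measure[OF spectral that])
  then show ?thesis
    by (auto simp: null_sets_def)
qed

text \<open>\<open>E \<rho>\<close> commutes with all \<open>E \<sigma>\<close>, so the scalar
  measure of \<open>E \<rho> f\<close> is dominated by that of \<open>f\<close>. The simple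
  functions that approximate \<open>u\<close> for \<open>f\<close> therefore also do so for
  \<open>E \<rho> f\<close>, and boundedness of \<open>E \<rho>\<close> carries the limit
  over.\<close>

lemma spectral_integral_commute:
  assumes \<rho>: "\<rho> \<in> sets borel_Rp" and fh: "(f, h) \<in> spectral_integral E u"
  shows "(E \<rho> f, E \<rho> h) \<in> spectral_integral E u"
proof -
  interpret bounded_linear "E \<rho>"
    by (rule orthogonal_projection_bounded_linear[OF proj[OF \<rho>]])
  obtain s where fin: "(\<integral>\<^sup>+x. ennreal ((u x)\<^sup>2) \<partial>scalar_measure E f) < \<infinity>"
    and s: "\<And>n. simple_function borel_Rp (s n)"
    and L2: "(\<lambda>n. \<integral>\<^sup>+x. ennreal ((u x - s n x)\<^sup>2) \<partial>scalar_measure E f) \<longlonglongrightarrow> 0"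
    and lim: "(\<lambda>n. simple_spectral_integral E (s n) f) \<longlonglongrightarrow> h"
    using fh by (auto simp: spectral_integral_def)
  have comm: "E \<sigma> (E \<rho> f) = E \<rho> (E \<sigma> f)" if "\<sigma> \<in> sets borel_Rp" for \<sigma>
    using that \<rho> by (simp add: E_Int Int_commute)
  have le: "scalar_measure E (E \<rho> f) \<le> scalar_measure E f"
  proof (simp add: le_measure_iff, rule le_funI)
    fix \<sigma>
    show "emeasure (scalar_measure E (E \<rho> f)) \<sigma> \<le> emeasure (scalar_measure E f) \<sigma>"
    proof (cases "\<sigma> \<in> sets borel_Rp")
      case \<sigma>: True
      have "(norm (E \<sigma> (E \<rho> f)))\<^sup>2 \<le> (norm (E \<sigma> f))\<^sup>2"
        unfolding comm[OF \<sigma>]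
        by (intro power_mono orthogonal_projection_norm_le[OF proj[OF \<rho>]]) simp
      then show ?thesis
        by (simp only: emeasure_scalar_measure[OF spectral \<sigma>] cinner_projection_self[OF proj[OF \<sigma>]]
            Re_complex_of_real ennreal_leI)
    qed (simp add: emeasure_notin_sets)
  qed
  have mono: "(\<integral>\<^sup>+x. g x \<partial>scalar_measure E (E \<rho> f)) \<le> (\<integral>\<^sup>+x. g x \<partial>scalar_measure E f)" for g
    by (rule nn_integral_mono_measure[OF _ le]) simp
  have "simple_spectral_integral E (s n) (E \<rho> f) = E \<rho> (simple_spectral_integral E (s n) f)" for n
  proof -
    have "s n -` {y} \<inter> {0..} \<in> sets borel_Rp" for y
      using simple_functionD(2)[OF s] by simp
    then show ?thesis
      by (simp add: simple_spectral_integral_def sum scaleR comm)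
  qed
  then have "(\<lambda>n. simple_spectral_integral E (s n) (E \<rho> f)) \<longlonglongrightarrow> E \<rho> h"
    using tendsto[OF lim] by simp
  moreover have "(\<lambda>n. \<integral>\<^sup>+x. ennreal ((u x - s n x)\<^sup>2) \<partial>scalar_measure E (E \<rho> f)) \<longlonglongrightarrow> 0"
    by (rule tendsto_sandwich[OF _ _ tendsto_const L2]) (auto intro: always_eventually mono)
  moreover have "(\<integral>\<^sup>+x. ennreal ((u x)\<^sup>2) \<partial>scalar_measure E (E \<rho> f)) < \<infinity>"
    using mono fin by (rule le_less_trans)
  ultimately show ?thesis
    unfolding spectral_integral_def using s by blast
qed

end

section \<open>The intertwining map\<close>

text \<open>Generated as a relation, so that being well defined becomes single-valuedness, to be
  proved afterwards. Adding one generator at a time fits the induction on sums; scalar multiples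
  come for free, since a scalar can be moved into \<open>f\<close>.\<close>

inductive_set intertwiner ::
  "(real set \<Rightarrow> 'a \<Rightarrow> 'a) \<Rightarrow> (real set \<Rightarrow> 'a \<Rightarrow> 'a) \<Rightarrow> 'a op_graph \<Rightarrow> 'a op_graph \<Rightarrow>
     ('a::complex_inner_space) op_graph"
  for P Q and A B :: "'a op_graph"
  where
    zero: "(0, 0) \<in> intertwiner P Q A B"
  | step: "(u, v) \<in> intertwiner P Q A B \<Longrightarrow> \<sigma> \<in> sets borel_Rp \<Longrightarrow> (f, k) \<in> A \<Longrightarrow> (f, b) \<in> B \<Longrightarrow>
      (u + P \<sigma> k, v + Q \<sigma> b) \<in> intertwiner P Q A B"

text \<open>To be used with \<open>pullback E \<psi>\<close> for \<open>P\<close>,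
  \<open>pullback E \<phi>\<close> for \<open>Q\<close> and the modulus of \<open>A\<close> for
  \<open>B\<close>.\<close>

locale intertwining =
  P: spectral_measure_space P + Q: spectral_measure_space Q
  for P Q :: "real set \<Rightarrow> 'a::complex_inner_space \<Rightarrow> 'a" +
  fixes A B :: "'a op_graph"
  assumes A: "linear_op A" and B: "linear_op B" and dom: "Domain A = Domain B"
begin

abbreviation "T \<equiv> intertwiner P Q A B"

lemma intertwiner_generator:
  assumes "\<sigma> \<in> sets borel_Rp" "(f, k) \<in> A" "(f, b) \<in> B"
  shows "(P \<sigma> k, Q \<sigma> b) \<in> T"
  using intertwiner.step[OF intertwiner.zero assms] by simp

lemma intertwiner_add:
  assumes "(u', v') \<in> T" "(u, v) \<in> T"
  shows "(u + u', v + v') \<in> T"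
  using assms
proof (induction rule: intertwiner.induct)
  case zero
  then show ?case by simp
next
  case (step u' v' \<sigma> f k b)
  then have "(u + u' + P \<sigma> k, v + v' + Q \<sigma> b) \<in> T"
    by (blast intro: intertwiner.step)
  then show ?case
    by (simp add: add.assoc)
qed

lemma intertwiner_scaleC:
  assumes "(u, v) \<in> T"
  shows "(c *\<^sub>C u, c *\<^sub>C v) \<in> T"
  using assms
proof induction
  case zero
  then show ?case by (simp add: intertwiner.zero)
next
  case (step u v \<sigma> f k b)
  from intertwiner.step[OF step.IH step.hyps(2) linear_op_scaleC[OF A step.hyps(3), of c]
      linear_op_scaleC[OF B step.hyps(4), of c]]
  show ?case
    using step.hyps(2) by (simp add: P.E_scaleC Q.E_scaleC scaleC_add_right)
qed

text \<open>By multiplicativity, \<open>P \<rho>\<close> and \<open>Q \<rho>\<close> send the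
  generator for \<sigma> to the generator for \<open>\<rho> \<inter> \<sigma>\<close>.\<close>

lemma intertwiner_intertwines:
  assumes "(u, v) \<in> T" and \<rho>: "\<rho> \<in> sets borel_Rp"
  shows "(P \<rho> u, Q \<rho> v) \<in> T"
  using assms(1)
proof induction
  case zero
  then show ?case by (simp add: intertwiner.zero P.E_zero Q.E_zero \<rho>)
next
  case (step u v \<sigma> f k b)
  have "\<rho> \<inter> \<sigma> \<in> sets borel_Rp"
    using step.hyps(2) \<rho> by blast
  from intertwiner.step[OF step.IH this step.hyps(3,4)] show ?case
    using step.hyps(2) \<rho> by (simp add: P.E_add Q.E_add P.E_Int Q.E_Int)
qed

text \<open>
  Carrying along the extra summand \<open>(k\<^sub>0, b\<^sub>0)\<close> and the set \<open>\<rho>\<close> avoids passing to a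
  common refinement of the sets \<open>\<sigma>\<close>: in the induction step \<open>\<rho>\<close> is split
  by \<open>\<sigma>\<close>, and the new vector \<open>f\<close> is absorbed into \<open>f\<^sub>0\<close> on \<open>\<rho> \<inter> \<sigma>\<close>.
\<close>

lemma intertwiner_kernel:
  assumes ac: "\<And>f k b \<sigma>. (f, k) \<in> A \<Longrightarrow> (f, b) \<in> B \<Longrightarrow> \<sigma> \<in> sets borel_Rp \<Longrightarrow>
      P \<sigma> k = 0 \<Longrightarrow> Q \<sigma> b = 0"
    and "(u, v) \<in> T"
  shows "\<rho> \<in> sets borel_Rp \<Longrightarrow> (f\<^sub>0, k\<^sub>0) \<in> A \<Longrightarrow> (f\<^sub>0, b\<^sub>0) \<in> B \<Longrightarrow>
    P \<rho> (k\<^sub>0 + u) = 0 \<Longrightarrow> Q \<rho> (b\<^sub>0 + v) = 0"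
  using assms(2)
proof (induction arbitrary: \<rho> f\<^sub>0 k\<^sub>0 b\<^sub>0)
  case zero
  then show ?case using ac by simp
next
  case (step u v \<sigma> f k b)
  let ?\<alpha> = "\<rho> \<inter> \<sigma>" and ?\<beta> = "\<rho> - \<sigma>"
  have m: "?\<alpha> \<in> sets borel_Rp" "?\<beta> \<in> sets borel_Rp"
    using step by auto
  note \<sigma> = \<open>\<sigma> \<in> sets borel_Rp\<close> and \<rho> = \<open>\<rho> \<in> sets borel_Rp\<close>
  have int: "?\<alpha> \<inter> \<sigma> = ?\<alpha>" "?\<beta> \<inter> \<sigma> = {}" "?\<alpha> \<inter> \<rho> = ?\<alpha>" "?\<beta> \<inter> \<rho> = ?\<beta>" "?\<alpha> \<inter> ?\<beta> = {}"
    "?\<alpha> \<union> ?\<beta> = \<rho>"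
    by auto
  have P0: "P ?\<alpha> (k\<^sub>0 + (u + P \<sigma> k)) = 0" "P ?\<beta> (k\<^sub>0 + (u + P \<sigma> k)) = 0"
    using P.E_Int[OF m(1) \<rho>, of "k\<^sub>0 + (u + P \<sigma> k)"] P.E_Int[OF m(2) \<rho>, of "k\<^sub>0 + (u + P \<sigma> k)"]
      step.prems m by (simp_all add: int P.E_zero)
  have "P ?\<alpha> ((k\<^sub>0 + k) + u) = 0"
    using P0(1) by (simp add: P.E_add m P.E_Int \<sigma> int algebra_simps)
  then have "Q ?\<alpha> ((b\<^sub>0 + b) + v) = 0"
    using step.IH[OF m(1) linear_op_add[OF A step.prems(2) step.hyps(3)]
        linear_op_add[OF B step.prems(3) step.hyps(4)]] by blast
  moreover have "P ?\<beta> (k\<^sub>0 + u) = 0"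
    using P0(2) by (simp add: P.E_add m P.E_Int \<sigma> int P.E_empty algebra_simps)
  then have "Q ?\<beta> (b\<^sub>0 + v) = 0"
    using step.IH[OF m(2) step.prems(2,3)] by blast
  ultimately have "Q ?\<alpha> (b\<^sub>0 + (v + Q \<sigma> b)) + Q ?\<beta> (b\<^sub>0 + (v + Q \<sigma> b)) = 0"
    by (simp add: Q.E_add m Q.E_Int \<sigma> int Q.E_empty algebra_simps)
  then show ?case
    using Q.E_Un[OF m int(5)] by (simp add: int)
qed

lemma linear_op_intertwiner:
  assumes ac: "\<And>f k b \<sigma>. (f, k) \<in> A \<Longrightarrow> (f, b) \<in> B \<Longrightarrow> \<sigma> \<in> sets borel_Rp \<Longrightarrow>
      P \<sigma> k = 0 \<Longrightarrow> Q \<sigma> b = 0"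
  shows "linear_op T"
  unfolding linear_op_def
proof (intro conjI allI impI)
  have R: "{0..} \<in> sets borel_Rp"
    using sets.top[of borel_Rp] by simp
  show "single_valued T"
  proof (rule single_valuedI)
    fix u v v' assume "(u, v) \<in> T" "(u, v') \<in> T"
    from intertwiner_add[OF intertwiner_scaleC[OF this(2), of "-1"] this(1)]
    have "(0, v - v') \<in> T"
      using scaleC_of_real[of "-1"] by simp
    \<comment> \<open>The kernel lemma with zero for the extra summand and the whole half-line,
      where both projections are the identity.\<close>
    have "Q {0..} (0 + (v - v')) = 0"
    proof (rule intertwiner_kernel[OF _ _ R linear_op_zero[OF A] linear_op_zero[OF B]])
      show "(0, v - v') \<in> T"
        by fact
    qed (simp_all add: ac P.E_zero[OF R])
    then show "v = v'"
      by (simp add: Q.E_space)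
  qed
qed (auto intro: intertwiner.zero intertwiner_add intertwiner_scaleC)

lemma Domain_intertwiner:
  "Domain T = cspan {P \<sigma> (op_app A f) | \<sigma> f. \<sigma> \<in> sets borel_Rp \<and> f \<in> Domain A}"
    (is "_ = cspan ?G")
proof
  show "Domain T \<subseteq> cspan ?G"
  proof
    fix u assume "u \<in> Domain T"
    then obtain v where "(u, v) \<in> T" by blast
    then show "u \<in> cspan ?G"
    proof induction
      case zero
      then show ?case by (rule complex_vector.span_zero)
    next
      case (step u v \<sigma> f k b)
      then have "P \<sigma> k \<in> ?G"
        using op_app_eq[OF A step.hyps(3)] by blast
      then show ?case
        by (intro complex_vector.span_add step.IH complex_vector.span_base)
    qed
  qed
  show "cspan ?G \<subseteq> Domain T"
  proof (rule complex_vector.span_minimal)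
    show "csubspace (Domain T)"
      unfolding complex_vector.subspace_def
      by (blast intro: intertwiner.zero intertwiner_add intertwiner_scaleC)
    show "?G \<subseteq> Domain T"
    proof clarify
      fix \<sigma> f k assume "\<sigma> \<in> sets borel_Rp" "(f, k) \<in> A"
      \<comment> \<open>Equality of the domains gives every generator of the span a partner under
        \<open>T\<close>.\<close>
      moreover from this dom obtain b where "(f, b) \<in> B"
        by blast
      ultimately show "P \<sigma> (op_app A f) \<in> Domain T"
        using intertwiner_generator op_app_eq[OF A] by (metis DomainI)
    qed
  qed
qed

lemma Range_intertwiner:
  assumes comm: "\<And>\<sigma> f h. \<sigma> \<in> sets borel_Rp \<Longrightarrow> (f, h) \<in> B \<Longrightarrow> Q \<sigma> h \<in> Range B"
  shows "Range T \<subseteq> Range B"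
proof
  fix v assume "v \<in> Range T"
  then obtain u where "(u, v) \<in> T" by blast
  then show "v \<in> Range B"
  proof induction
    case zero
    then show ?case using linear_op_zero[OF B] by blast
  next
    case (step u v \<sigma> f k b)
    then show ?case using comm[OF step.hyps(2,4)] linear_op_add[OF B] by blast
  qed
qed

end

section \<open>Forced values on generators, and uniqueness\<close>

text \<open>The whole half-line in place of \<sigma> shows that \<open>k\<close> itself lies in the
  domain of \<open>T\<^sub>0\<close>, so \<open>A O T\<^sub>0 = B\<close> fixes its value there; the
  intertwining relation then gives the value at \<open>pullback E \<psi> \<sigma> k\<close>.\<close>

lemma is_T0_on_generator:
  assumes T0: "is_T0 E \<phi> \<psi> A B T\<^sub>0" and A: "linear_op A"
    and \<psi>: "spectral_measure (pullback E \<psi>)"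
    and \<sigma>: "\<sigma> \<in> sets borel_Rp" and fk: "(f, k) \<in> A"
  obtains b where "(f, b) \<in> B" "(pullback E \<psi> \<sigma> k, pullback E \<phi> \<sigma> b) \<in> T\<^sub>0"
proof -
  interpret P: spectral_measure_space "pullback E \<psi>"
    by unfold_locales (rule \<psi>)
  have R: "{0..} \<in> sets borel_Rp"
    using sets.top[of borel_Rp] by simp
  have "k = pullback E \<psi> {0..} (op_app A f)"
    by (simp add: P.E_space op_app_eq[OF A fk])
  then have kH: "k \<in> H0_space E \<psi> A"
    unfolding H0_space_def using R fk by (intro complex_vector.span_base) blast
  then obtain b where kb: "(k, b) \<in> T\<^sub>0"
    using T0 unfolding is_T0_def by blast
  with fk T0 have "(f, b) \<in> B"
    unfolding is_T0_def by blast
  moreover have "(k, pullback E \<phi> \<sigma> b) \<in> T\<^sub>0 O fun_graph UNIV (pullback E \<phi> \<sigma>)"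
    using kb by (auto simp: fun_graph_def)
  then have "(k, pullback E \<phi> \<sigma> b) \<in> fun_graph (H0_space E \<psi> A) (pullback E \<psi> \<sigma>) O T\<^sub>0"
    using T0 \<sigma> unfolding is_T0_def by blast
  then have "(pullback E \<psi> \<sigma> k, pullback E \<phi> \<sigma> b) \<in> T\<^sub>0"
    by (auto simp: fun_graph_def)
  ultimately show ?thesis
    using that by blast
qed

text \<open>The vectors on which \<open>T\<close> and \<open>T'\<close> agree form a complex
  subspace that contains all generators. Exchanging the two maps gives uniqueness.\<close>

lemma is_T0_mono:
  assumes T: "is_T0 E \<phi> \<psi> A B T" and T': "is_T0 E \<phi> \<psi> A B T'"
    and A: "linear_op A" and B: "linear_op B" and \<psi>: "spectral_measure (pullback E \<psi>)"
  shows "T \<subseteq> T'"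
proof -
  have lin: "linear_op T" "linear_op T'"
    using T T' by (auto simp: is_T0_def)
  let ?U = "{u. \<exists>v. (u, v) \<in> T \<and> (u, v) \<in> T'}"
  have "H0_space E \<psi> A \<subseteq> ?U"
    unfolding H0_space_def
  proof (rule complex_vector.span_minimal)
    show "csubspace ?U"
      unfolding complex_vector.subspace_def
      using lin linear_op_zero linear_op_add linear_op_scaleC by blast
    show "{pullback E \<psi> \<sigma> (op_app A f) |\<sigma> f. \<sigma> \<in> sets borel_Rp \<and> f \<in> Domain A} \<subseteq> ?U"
    proof clarify
      fix \<sigma> f k assume \<sigma>: "\<sigma> \<in> sets borel_Rp" and fk: "(f, k) \<in> A"
      obtain b b' where b: "(f, b) \<in> B" "(pullback E \<psi> \<sigma> k, pullback E \<phi> \<sigma> b) \<in> T"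
        and b': "(f, b') \<in> B" "(pullback E \<psi> \<sigma> k, pullback E \<phi> \<sigma> b') \<in> T'"
        using is_T0_on_generator[OF T A \<psi> \<sigma> fk] is_T0_on_generator[OF T' A \<psi> \<sigma> fk] by metis
      have "b' = b"
        by (rule linear_op_unique[OF B b'(1) b(1)])
      with b b' show "\<exists>v. (pullback E \<psi> \<sigma> (op_app A f), v) \<in> T \<and>
          (pullback E \<psi> \<sigma> (op_app A f), v) \<in> T'"
        unfolding op_app_eq[OF A fk] by blast
    qed
  qed
  note common = subsetD[OF this]
  show ?thesis
  proof clarify
    fix u v assume uv: "(u, v) \<in> T"
    then have "u \<in> H0_space E \<psi> A"
      using T unfolding is_T0_def by blast
    then show "(u, v) \<in> T'"
      using common linear_op_unique[OF lin(1) uv] by blast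
  qed
qed

theorem theorem9p4:
  fixes \<phi> \<psi> :: "real \<Rightarrow> real"
    and A absA :: "'a::chilbert_space op_graph"
    and E :: "real set \<Rightarrow> 'a \<Rightarrow> 'a"
  assumes "\<phi> \<in> borel_Rp \<rightarrow>\<^sub>M borel_Rp"
    and "\<psi> \<in> borel_Rp \<rightarrow>\<^sub>M borel_Rp"
    and "closed_op A"
    and "densely_defined A"
    and "modulus_of A absA"
    and "spectral_measure_of E absA"
  shows "((\<forall>f\<in>Domain A. absolutely_continuous
             (scalar_measure (pullback E \<psi>) (op_app A f))
             (scalar_measure (pullback E \<phi>) (op_app absA f)))
           \<longleftrightarrow> (\<exists>T\<^sub>0. is_T0 E \<phi> \<psi> A absA T\<^sub>0))
         \<and> (\<exists>\<^sub>\<le>\<^sub>1 T\<^sub>0. is_T0 E \<phi> \<psi> A absA T\<^sub>0)"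
proof -
  have A: "linear_op A" and B: "linear_op absA"
    using assms by (auto simp: closed_op_def modulus_of_def selfadjoint_op_def)
  have E: "spectral_measure E" and absA: "absA = spectral_integral E (\<lambda>x. x)"
    using assms by (auto simp: spectral_measure_of_def)
  have dom: "Domain A = Domain absA"
    by (rule modulus_of_Domain) fact+
  note \<psi>E = spectral_measure_pullback[OF E assms(2)]
  interpret E: spectral_measure_space E
    by unfold_locales (rule E)
  interpret I: intertwining "pullback E \<psi>" "pullback E \<phi>" A absA
    by unfold_locales (rule \<psi>E spectral_measure_pullback[OF E assms(1)] A B dom)+
  have R: "{0..} \<in> sets borel_Rp"
    using sets.top[of borel_Rp] by simp
  let ?ac = "\<forall>f\<in>Domain A. absolutely_continuous
             (scalar_measure (pullback E \<psi>) (op_app A f))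
             (scalar_measure (pullback E \<phi>) (op_app absA f))"
  \<comment> \<open>Condition (i) in the form that the kernel lemma takes as its hypothesis.\<close>
  have ac_iff: "?ac \<longleftrightarrow> (\<forall>f k b \<sigma>. (f, k) \<in> A \<longrightarrow> (f, b) \<in> absA \<longrightarrow> \<sigma> \<in> sets borel_Rp \<longrightarrow>
      pullback E \<psi> \<sigma> k = 0 \<longrightarrow> pullback E \<phi> \<sigma> b = 0)" (is "_ \<longleftrightarrow> ?K")
  proof
    assume ac: ?ac
    show ?K
    proof (intro allI impI)
      fix f k b \<sigma>
      assume fk: "(f, k) \<in> A" and fb: "(f, b) \<in> absA"
        and "\<sigma> \<in> sets borel_Rp" "pullback E \<psi> \<sigma> k = 0"
      with ac have "\<sigma> \<in> null_sets (scalar_measure (pullback E \<phi>) (op_app absA f))"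
        unfolding absolutely_continuous_def
        by (force simp: I.P.null_sets_scalar_measure op_app_eq[OF A fk])
      then show "pullback E \<phi> \<sigma> b = 0"
        by (simp add: I.Q.null_sets_scalar_measure op_app_eq[OF B fb])
    qed
  next
    assume K: ?K
    show ?ac
    proof
      fix f assume "f \<in> Domain A"
      with dom obtain k b where "(f, k) \<in> A" "(f, b) \<in> absA"
        by blast
      with K show "absolutely_continuous (scalar_measure (pullback E \<psi>) (op_app A f))
          (scalar_measure (pullback E \<phi>) (op_app absA f))"
        by (auto simp: absolutely_continuous_def I.P.null_sets_scalar_measure
            I.Q.null_sets_scalar_measure op_app_eq[OF A] op_app_eq[OF B])
    qed
  qed
  \<comment> \<open>From (i) to (ii): the witness is the generated relation, which \<open>?K\<close>
    makes single-valued.\<close>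
  have "is_T0 E \<phi> \<psi> A absA I.T" if K: ?K
    unfolding is_T0_def
  proof (intro conjI ballI)
    show lin: "linear_op I.T"
      using K by (intro I.linear_op_intertwiner) blast
    show domT: "Domain I.T = H0_space E \<psi> A"
      unfolding H0_space_def by (rule I.Domain_intertwiner)
    show "Range I.T \<subseteq> Range absA"
    proof (rule I.Range_intertwiner)
      fix \<sigma> f h assume \<sigma>: "\<sigma> \<in> sets borel_Rp" and "(f, h) \<in> absA"
      moreover have "\<phi> -` \<sigma> \<inter> {0..} \<in> sets borel_Rp"
        using measurable_sets[OF assms(1) \<sigma>] by simp
      ultimately show "pullback E \<phi> \<sigma> h \<in> Range absA"
        unfolding absA pullback_def using E.spectral_integral_commute by blast
    qed
    \<comment> \<open>The generator for the whole half-line, where both pullbacks are the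
      identity.\<close>
    have kb: "(k, b) \<in> I.T" if "(f, k) \<in> A" "(f, b) \<in> absA" for f k b
      using I.intertwiner_generator[OF R that] by (simp add: I.P.E_space I.Q.E_space)
    show "A O I.T = absA"
    proof (intro equalityI subrelI)
      fix f h assume "(f, h) \<in> A O I.T"
      then obtain k where k: "(f, k) \<in> A" "(k, h) \<in> I.T"
        by blast
      with dom obtain b where b: "(f, b) \<in> absA"
        by blast
      with k kb linear_op_unique[OF lin] show "(f, h) \<in> absA"
        by blast
    next
      fix f b assume "(f, b) \<in> absA"
      with dom kb show "(f, b) \<in> A O I.T"
        by blast
    qed
    fix \<sigma> assume \<sigma>: "\<sigma> \<in> sets borel_Rp"
    show "fun_graph (H0_space E \<psi> A) (pullback E \<psi> \<sigma>) O I.T =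
        I.T O fun_graph UNIV (pullback E \<phi> \<sigma>)"
    proof (intro equalityI subrelI)
      fix u w assume "(u, w) \<in> fun_graph (H0_space E \<psi> A) (pullback E \<psi> \<sigma>) O I.T"
      then have "u \<in> Domain I.T" "(pullback E \<psi> \<sigma> u, w) \<in> I.T"
        by (auto simp: fun_graph_def domT)
      \<comment> \<open>Intertwining produces one value at
        \<open>pullback E \<psi> \<sigma> u\<close>; single-valuedness identifies it with
        \<open>w\<close>.\<close>
      then obtain v where "(u, v) \<in> I.T" "w = pullback E \<phi> \<sigma> v"
        using I.intertwiner_intertwines[OF _ \<sigma>] linear_op_unique[OF lin] by blast
      then show "(u, w) \<in> I.T O fun_graph UNIV (pullback E \<phi> \<sigma>)"
        by (auto simp: fun_graph_def)
    next
      fix u w assume "(u, w) \<in> I.T O fun_graph UNIV (pullback E \<phi> \<sigma>)"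
      then obtain v where v: "(u, v) \<in> I.T" "w = pullback E \<phi> \<sigma> v"
        by (auto simp: fun_graph_def)
      then have "(pullback E \<psi> \<sigma> u, w) \<in> I.T"
        using I.intertwiner_intertwines[OF _ \<sigma>] by blast
      moreover have "u \<in> H0_space E \<psi> A"
        using v domT by blast
      ultimately show "(u, w) \<in> fun_graph (H0_space E \<psi> A) (pullback E \<psi> \<sigma>) O I.T"
        by (auto simp: fun_graph_def)
    qed
  qed
  \<comment> \<open>From (ii) to (i): the linear map sends
    \<open>pullback E \<psi> \<sigma> k\<close> to \<open>pullback E \<phi> \<sigma> b\<close>, so
    if the former vanishes, so does the latter.\<close>
  moreover have ?K if T0: "is_T0 E \<phi> \<psi> A absA T\<^sub>0" for T\<^sub>0
  proof (intro allI impI)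
    fix f k b \<sigma>
    assume fk: "(f, k) \<in> A" and fb: "(f, b) \<in> absA" and \<sigma>: "\<sigma> \<in> sets borel_Rp"
      and 0: "pullback E \<psi> \<sigma> k = 0"
    obtain b' where "(f, b') \<in> absA" and T: "(pullback E \<psi> \<sigma> k, pullback E \<phi> \<sigma> b') \<in> T\<^sub>0"
      using is_T0_on_generator[OF T0 A \<psi>E \<sigma> fk] by blast
    moreover from this fb have "b' = b"
      using linear_op_unique[OF B] by blast
    moreover have "linear_op T\<^sub>0"
      using T0 by (simp add: is_T0_def)
    ultimately show "pullback E \<phi> \<sigma> b = 0"
      using 0 linear_op_zero linear_op_unique by metis
  qed
  moreover have "\<exists>\<^sub>\<le>\<^sub>1 T\<^sub>0. is_T0 E \<phi> \<psi> A absA T\<^sub>0"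
    using is_T0_mono[OF _ _ A B \<psi>E] by (intro Uniq_I equalityI)
  ultimately show ?thesis
    unfolding ac_iff by blast
qed

end
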